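(* Let $t$ be an even integer such that $t\neq 2^s-2$ for any integer $s$. Then $$\frac{t-1}{2}n+O(1)\le\mathrm{ex}^*(n,B_{t,3})\le\left(\frac{t+1}{2}-\frac{1}{t+2}\right)n.$$
   Context: All graphs are finite and simple. An edge-coloring of a graph is a function $c:E(G)\to\mathbb{N}$; it is proper if incident edges receive different colors. A subgraph is rainbow under $c$ if its edges have pairwise distinct colors. A graph $G$ is rainbow-$F$-free if it admits a proper edge-coloring under which no (not necessarily induced) copy of $F$ in $G$ is rainbow. The rainbow Turán number $\mathrm{ex}^*(n,F)$ is the maximum number of edges in an $n$-vertex rainbow-$F$-free graph. For $t\ge 3$ (as is always assumed), $B_{t,3}$ is the broom with $t$ edges and handle length $3$: the tree obtained from a path with $3$ edges (the handle) by adding $t-3$ pendant edges (the bristles) at one end vertex of the path. Here $O(1)$ is a quantity bounded by a constant depending only on $t$, as $n\to\infty$. *)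

theory Defs
  imports Complex_Main "HOL-Library.Landau_Symbols"
begin

type_synonym 'a graph = "'a set \<times> 'a set set"

abbreviation verts :: "'a graph \<Rightarrow> 'a set" where
  "verts G \<equiv> fst G"

abbreviation edges :: "'a graph \<Rightarrow> 'a set set" where
  "edges G \<equiv> snd G"

definition simple_graph :: "'a graph \<Rightarrow> bool" where
  "simple_graph G \<longleftrightarrow> finite (verts G) \<and> (\<forall>e\<in>edges G. e \<subseteq> verts G \<and> card e = 2)"

definition subgraph_of :: "'a graph \<Rightarrow> 'a graph \<Rightarrow> bool" where
  "subgraph_of H G \<longleftrightarrow> simple_graph H \<and> verts H \<subseteq> verts G \<and> edges H \<subseteq> edges G"

definition graph_iso :: "'a graph \<Rightarrow> 'b graph \<Rightarrow> bool" where
  "graph_iso G H \<longleftrightarrow>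
    (\<exists>f. bij_betw f (verts G) (verts H) \<and> edges H = (\<lambda>e. f ` e) ` edges G)"

definition copy_of_in :: "'a graph \<Rightarrow> 'b graph \<Rightarrow> 'a graph \<Rightarrow> bool" where
  "copy_of_in H F G \<longleftrightarrow> subgraph_of H G \<and> graph_iso F H"

text \<open>Colorings are total functions; only their values on the edges of the graph matter.\<close>

definition proper_edge_coloring :: "'a graph \<Rightarrow> ('a set \<Rightarrow> nat) \<Rightarrow> bool" where
  "proper_edge_coloring G c \<longleftrightarrow>
    (\<forall>e\<in>edges G. \<forall>e'\<in>edges G. e \<noteq> e' \<and> e \<inter> e' \<noteq> {} \<longrightarrow> c e \<noteq> c e')"

definition rainbow :: "('a set \<Rightarrow> nat) \<Rightarrow> 'a graph \<Rightarrow> bool" where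
  "rainbow c H \<longleftrightarrow> inj_on c (edges H)"

definition rainbow_free :: "'b graph \<Rightarrow> 'a graph \<Rightarrow> bool" where
  "rainbow_free F G \<longleftrightarrow>
    (\<exists>c. proper_edge_coloring G c \<and> \<not> (\<exists>H. copy_of_in H F G \<and> rainbow c H))"

text \<open>
  Every finite graph is isomorphic to one whose vertices are natural numbers, so it suffices to
  let \<open>G\<close> range over those. The set is always finite, and it is nonempty whenever \<open>F\<close> has an
  edge, so \<open>Max\<close> is meaningful in that case (see the two lemmas below).
\<close>

definition rainbow_edge_counts :: "nat \<Rightarrow> 'b graph \<Rightarrow> nat set" where
  "rainbow_edge_counts n F =
    {card (edges G) | G :: nat graph. simple_graph G \<and> card (verts G) = n \<and> rainbow_free F G}"

definition rainbow_turan :: "nat \<Rightarrow> 'b graph \<Rightarrow> nat" where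
  "rainbow_turan n F = Max (rainbow_edge_counts n F)"

lemma finite_rainbow_edge_counts: "finite (rainbow_edge_counts n F)"
proof (rule finite_subset)
  show "rainbow_edge_counts n F \<subseteq> {..2 ^ n}"
  proof
    fix k assume "k \<in> rainbow_edge_counts n F"
    then obtain G :: "nat graph"
      where G: "k = card (edges G)" "simple_graph G" "card (verts G) = n"
      unfolding rainbow_edge_counts_def by blast
    have "finite (verts G)" "edges G \<subseteq> Pow (verts G)"
      using G(2) unfolding simple_graph_def by auto
    then have "card (edges G) \<le> card (Pow (verts G))"
      by (intro card_mono) auto
    then show "k \<in> {..2 ^ n}"
      using G \<open>finite (verts G)\<close> by (simp add: card_Pow)
  qed
qed simp

lemma rainbow_edge_counts_nonempty:
  assumes "edges F \<noteq> {}"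
  shows "rainbow_edge_counts n F \<noteq> {}"
proof -
  let ?G = "({..<n}, {}) :: nat graph"
  have "rainbow_free F ?G"
    using assms unfolding rainbow_free_def proper_edge_coloring_def copy_of_in_def
      subgraph_of_def graph_iso_def by auto
  moreover have "simple_graph ?G" "card (verts ?G) = n"
    by (auto simp: simple_graph_def)
  ultimately show ?thesis
    unfolding rainbow_edge_counts_def by blast
qed

text \<open>
  \<open>broom t l\<close> is the broom with \<open>t\<close> edges and handle length \<open>l\<close> (for \<open>1 \<le> l \<le> t\<close>): the handle is
  the path \<open>0, 1, \<dots>, l\<close>, and the bristles join \<open>l\<close> to the leaves \<open>l + 1, \<dots>, t\<close>.
\<close>

definition broom :: "nat \<Rightarrow> nat \<Rightarrow> nat graph" where
  "broom t l = ({0..t}, {{i, i + 1} | i. i < l} \<union> {{l, j} | j. l < j \<and> j \<le> t})"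

end

(*
  Upper bound: in a counterexample with the fewest vertices, every nonempty vertex set U meets more
  than t(t+3)/(2(t+2)) |U| edges, so all degrees are at least 3 and some vertex v has degree at least
  t+1. If v a b w is a rainbow path and no rainbow broom is centred at v, then v cannot have more than
  t+1 neighbours, and with exactly t+1 it is adjacent to b and w, sees the colour of ab, and does not
  see it at w. (If v has more than t+1 neighbours and starts no rainbow path, then all its neighbours
  have degree 3, and its closed neighbourhood meets too few edges.) Hence the closed neighbourhood of
  v is a component, and the edge count forces it to be K_{t+2}, in which every vertex sees every
  colour. The colours then act as commuting involutions, one for each vertex other than a base
  point, which makes the component an elementary abelian 2-group, so t+2 is a power of two.
*)

theory Submission imports Defs begin

section \<open>Elementary abelian 2-groups\<close>

lemma card_power_of_two_if_commuting_involutions: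
  fixes F :: "'a \<Rightarrow> 'a \<Rightarrow> 'a"
  assumes fin: "finite U" and z: "z \<in> U"
    and closed: "\<And>u w. u \<in> U \<Longrightarrow> w \<in> U \<Longrightarrow> F u w \<in> U"
    and base: "\<And>u. u \<in> U \<Longrightarrow> F u z = u"
    and invol: "\<And>u p. u \<in> U \<Longrightarrow> p \<in> U \<Longrightarrow> F u (F u p) = p"
    and comm: "\<And>u w p. u \<in> U \<Longrightarrow> w \<in> U \<Longrightarrow> p \<in> U \<Longrightarrow> F u (F w p) = F w (F u p)"
  shows "\<exists>k. card U = 2 ^ k"
proof -
  have sym: "F u w = F w u" if "u \<in> U" "w \<in> U" for u w
    using comm[OF that z] base that by simp
  have assoc: "F (F u w) p = F u (F w p)" if "u \<in> U" "w \<in> U" "p \<in> U" for u w p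
  proof -
    have "F (F u w) p = F p (F u w)" using sym closed that by simp
    also have "\<dots> = F u (F p w)" using comm that by simp
    also have "\<dots> = F u (F w p)" using sym that by simp
    finally show ?thesis .
  qed
  have "\<exists>k. card U = 2 ^ k"
    if "H \<subseteq> U" "z \<in> H" "\<And>h k. h \<in> H \<Longrightarrow> k \<in> H \<Longrightarrow> F h k \<in> H" "card H = 2 ^ j" for H j
    using that
  proof (induction "card (U - H)" arbitrary: H j rule: less_induct)
    case less
    show ?case
    proof (cases "H = U")
      case True
      then show ?thesis using less.prems by auto
    next
      case False
      then obtain x where x: "x \<in> U" "x \<notin> H" using less.prems(1) by blast
      let ?K = "F x ` H"
      have HU: "h \<in> U" if "h \<in> H" for h using that less.prems(1) by blast
      have finH: "finite H" using fin less.prems(1) finite_subset by blast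
      have K_U: "?K \<subseteq> U" using x HU closed by auto
      have inj: "inj_on (F x) H"
        by (rule inj_on_inverseI[where g = "F x"]) (use invol x HU in auto)
      \<comment> \<open>If \<open>F x h\<close> were in \<open>H\<close>, so would be its product
        with \<open>h\<close>, which is \<open>x\<close>.\<close>
      have disj: "H \<inter> ?K = {}"
      proof (rule ccontr)
        assume "H \<inter> ?K \<noteq> {}"
        then obtain h where h: "h \<in> H" "F x h \<in> H" by blast
        have "F h (F x h) = x" using sym[of x h] invol[of h x] x HU h by simp
        then show False using less.prems(3)[OF h] x by simp
      qed
      have clo: "F h k \<in> H \<union> ?K" if hk: "h \<in> H \<union> ?K" "k \<in> H \<union> ?K" for h k
      proof -
        consider "h \<in> H" "k \<in> H" | k' where "h \<in> H" "k' \<in> H" "k = F x k'"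
          | h' where "h' \<in> H" "h = F x h'" "k \<in> H"
          | h' k' where "h' \<in> H" "k' \<in> H" "h = F x h'" "k = F x k'"
          using hk by blast
        then show ?thesis
        proof cases
          case 1 then show ?thesis using less.prems(3) by blast
        next
          case 2
          then have "F h k = F x (F h k')" using comm x HU by simp
          then show ?thesis using less.prems(3) 2 by blast
        next
          case 3
          then have "F h k = F x (F h' k)" using assoc x HU by simp
          then show ?thesis using less.prems(3) 3 by blast
        next
          case 4
          then have "F h k = F x (F h' (F x k'))" using assoc x HU closed by simp
          also have "\<dots> = F x (F x (F h' k'))" using comm 4 x HU by simp
          also have "\<dots> = F h' k'" using invol 4 x HU closed by simp
          finally show ?thesis using less.prems(3) 4 by simp
        qed
      qed
      have "x \<in> ?K" using base[OF x(1)] less.prems(2) by force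
      then have "U - (H \<union> ?K) \<subset> U - H" using x by blast
      then have "card (U - (H \<union> ?K)) < card (U - H)" using fin by (simp add: psubset_card_mono)
      moreover have "card (H \<union> ?K) = 2 ^ Suc j"
        using card_Un_disjoint[OF finH _ disj] finH card_image[OF inj] less.prems(4) by simp
      ultimately show ?thesis
        using less.hyps[of "H \<union> ?K" "Suc j"] less.prems(1,2) K_U clo by blast
    qed
  qed
  from this[of "{z}" 0] show ?thesis using z base by auto
qed

section \<open>The edges of the broom, and the lower bound\<close>

lemma edges_broom_3:
  "edges (broom t 3) = {{0, 1}, {1, 2}, {2, 3}} \<union> (\<lambda>j. {3, j}) ` {4..t}"
proof -
  have 1: "{i. i < 3} = {0, 1, 2::nat}" by auto
  have "{{i, i + 1} | i. i < 3} = (\<lambda>i. {i, i + 1}) ` {i. i < (3::nat)}" by blast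
  also have "\<dots> = {{0, 1}, {1, 2}, {2, 3::nat}}" unfolding 1 by (simp add: numeral_2_eq_2 numeral_3_eq_3)
  finally have "{{i, i + 1} | i. i < 3} = {{0, 1}, {1, 2}, {2, 3::nat}}" .
  moreover have "{j. 3 < j \<and> j \<le> t} = {4..t}" by auto
  then have "{{3, j} | j. 3 < j \<and> j \<le> t} = (\<lambda>j. {3, j}) ` {4..t}" by blast
  ultimately show ?thesis unfolding broom_def snd_conv by (rule arg_cong2)
qed

lemma card_edges_broom_3:
  assumes "t \<ge> 3"
  shows "card (edges (broom t 3)) = t"
proof -
  \<comment> \<open>The edge with larger endpoint \<open>j + 1\<close> has \<open>min j 3\<close> as
    its other endpoint, so \<open>h\<close> lists the edges and \<open>Max\<close> inverts
    it.\<close>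
  define h where "h = (\<lambda>j::nat. {min j 3, j + 1})"
  have split: "{..<t} = {0, 1, 2} \<union> {3..<t}" using assms by auto
  have "h ` {3..<t} = (\<lambda>j. {3, j}) ` {4..t}"
  proof (intro equalityI image_subsetI)
    show "h j \<in> (\<lambda>j. {3, j}) ` {4..t}" if "j \<in> {3..<t}" for j
      using that by (intro image_eqI[of _ _ "j + 1"]) (auto simp: h_def)
    show "{3, j} \<in> h ` {3..<t}" if "j \<in> {4..t}" for j
      using that by (intro image_eqI[of _ _ "j - 1"]) (auto simp: h_def min_def)
  qed
  moreover have "h ` {0, 1, 2} = {{0, 1}, {1, 2}, {2, 3}}"
    by (simp add: h_def numeral_3_eq_3 numeral_2_eq_2)
  ultimately have "edges (broom t 3) = h ` {..<t}"
    by (simp only: edges_broom_3 split image_Un)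
  moreover have "inj_on h {..<t}"
    by (rule inj_on_inverseI[where g = "\<lambda>e. Max e - 1"]) (simp add: h_def)
  ultimately show ?thesis by (simp only: card_image card_lessThan)
qed

lemma card_edges_graph_iso:
  assumes "graph_iso F H" "\<And>e. e \<in> edges F \<Longrightarrow> e \<subseteq> verts F"
  shows "card (edges H) = card (edges F)"
proof -
  obtain f where f: "bij_betw f (verts F) (verts H)" "edges H = (\<lambda>e. f ` e) ` edges F"
    using assms(1) unfolding graph_iso_def by blast
  have "inj_on ((`) f) (edges F)"
    by (rule inj_on_image) (use f(1) assms(2) in \<open>auto simp: bij_betw_def intro: inj_on_subset\<close>)
  then show ?thesis using f(2) by (simp add: card_image)
qed

text \<open>Disjoint copies of \<open>K\<^bsub>m,m\<^esub>\<close> with \<open>m = t - 1\<close> are properly coloured by the \<open>m\<close> sums of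
  endpoints modulo \<open>m\<close>, too few for a rainbow graph with \<open>t\<close> edges.\<close>

lemma rainbow_turan_broom_lower:
  assumes t: "t \<ge> 3"
  shows "(real t - 1) / 2 * real n - real ((t - 1)\<^sup>2) \<le> real (rainbow_turan n (broom t 3))"
proof -
  define m where "m = t - 1"
  have m: "m > 0" using t by (simp add: m_def)
  \<comment> \<open>Each copy of K_{m,m} takes \<open>2 * m\<close> vertices, so \<open>q\<close>
    copies fit.\<close>
  define q where "q = n div (2 * m)"
  define A where "A = {..<q} \<times> {..<m} \<times> {..<m}"
  \<comment> \<open>Cut the numbers into blocks of length \<open>m\<close>. Copy \<open>k\<close>
    has blocks \<open>2 * k\<close> and \<open>2 * k + 1\<close> as its sides, and
    \<open>(k, i, j)\<close> stands for the edge from position \<open>i\<close> of the first to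
    position \<open>j\<close> of the second.\<close>
  define edge where "edge = (\<lambda>(k, i, j). {2 * k * m + i, (2 * k + 1) * m + j})"
  define E where "E = edge ` A"
  \<comment> \<open>Division by \<open>m\<close> recovers block and position, and the parity of the
    block tells the side; so edges that meet share a first or a second endpoint.\<close>
  have edge_eqD: "k = k' \<and> i = i' \<or> k = k' \<and> j = j'"
    if "edge (k, i, j) \<inter> edge (k', i', j') \<noteq> {}" "(k, i, j) \<in> A" "(k', i', j') \<in> A" for k i j k' i' j'
  proof -
    have lt: "i < m" "j < m" "i' < m" "j' < m" using that by (auto simp: A_def)
    have dm: "(a * m + i) div m = a" "(a * m + i) mod m = i" if "i < m" for a i
      using that by auto
    have eq: "a = b \<and> r = s" if "a * m + r = b * m + s" "r < m" "s < m" for a b r s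
      using dm[OF that(2), of a] dm[OF that(3), of b] that(1) by metis
    have "2 * k * m + i = 2 * k' * m + i' \<or> 2 * k * m + i = (2 * k' + 1) * m + j' \<or>
      (2 * k + 1) * m + j = 2 * k' * m + i' \<or> (2 * k + 1) * m + j = (2 * k' + 1) * m + j'"
      using that(1) unfolding edge_def by blast
    then have "2 * k = 2 * k' \<and> i = i' \<or> 2 * k = 2 * k' + 1 \<or> 2 * k + 1 = 2 * k' \<or>
      2 * k + 1 = 2 * k' + 1 \<and> j = j'"
      using eq[of "2 * k" i "2 * k'" i'] eq[of "2 * k" i "2 * k' + 1" j']
        eq[of "2 * k + 1" j "2 * k'" i'] eq[of "2 * k + 1" j "2 * k' + 1" j'] lt
      by blast
    then show ?thesis by presburger
  qed
  have sum_edge: "\<Sum>(edge (k, i, j)) mod m = (i + j) mod m" if "(k, i, j) \<in> A" for k i j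
  proof -
    have "2 * k * m + i \<noteq> (2 * k + 1) * m + j" using that by (auto simp: A_def algebra_simps)
    then have "\<Sum>(edge (k, i, j)) = (i + j) + (4 * k + 1) * m"
      by (simp add: edge_def algebra_simps)
    then show ?thesis by (metis mod_mult_self1)
  qed
  have mod_le: "s \<le> r" if "(a + r) mod m = (a + s) mod m" "s < m" for a r s
  proof (rule ccontr)
    assume "\<not> s \<le> r"
    then have "m dvd s - r" using that(1) mod_eq_dvd_iff_nat[of "a + r" "a + s" m] by auto
    then show False using \<open>\<not> s \<le> r\<close> that(2) by (auto dest: dvd_imp_le)
  qed
  have mod_eq: "r = s" if "(a + r) mod m = (a + s) mod m" "r < m" "s < m" for a r s
    using mod_le[of a r s] mod_le[of a s r] that by simp
  \<comment> \<open>This serves both for injectivity of \<open>edge\<close> and for properness: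
    edges that meet share one coordinate, and the residue of \<open>i + j\<close> then determines
    the other.\<close>
  have edge_unique: "x = y"
    if xy: "x \<in> A" "y \<in> A" "edge x \<inter> edge y \<noteq> {}" "\<Sum>(edge x) mod m = \<Sum>(edge y) mod m" for x y
  proof -
    obtain k i j where x: "x = (k, i, j)" by (cases x)
    obtain k' i' j' where y: "y = (k', i', j')" by (cases y)
    have lt: "i < m" "j < m" "i' < m" "j' < m" using xy(1,2) by (simp_all add: A_def x y)
    have eq: "(i + j) mod m = (i' + j') mod m"
      using sum_edge[of k i j] sum_edge[of k' i' j'] xy(1,2,4) unfolding x y by simp
    from edge_eqD[of k i j k' i' j'] xy have "k = k' \<and> i = i' \<or> k = k' \<and> j = j'"
      unfolding x y by blast
    then show ?thesis
    proof (elim disjE conjE)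
      assume "k = k'" "i = i'"
      then show ?thesis using mod_eq[of i j j'] eq lt by (simp add: x y)
    next
      assume "k = k'" "j = j'"
      then show ?thesis using mod_eq[of j i i'] eq lt by (simp add: x y add.commute)
    qed
  qed
  have inj: "inj_on edge A"
  proof (rule inj_onI)
    fix x y assume xy: "x \<in> A" "y \<in> A" "edge x = edge y"
    have "edge x \<inter> edge y \<noteq> {}" unfolding xy(3) by (cases y) (simp add: edge_def)
    then show "x = y" using edge_unique xy by simp
  qed
  define G where "G = ({..<n}, E)"
  define c where "c = (\<lambda>e::nat set. \<Sum>e mod m)"
  have qn: "2 * m * q \<le> n" "n < 2 * m * q + 2 * m"
    using m dividend_less_times_div[of "2 * m" n] by (auto simp: q_def)
  have "e \<subseteq> {..<n} \<and> card e = 2" if "e \<in> E" for e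
  proof -
    from that obtain k i j where e: "e = edge (k, i, j)" "k < q" "i < m" "j < m"
      by (auto simp: E_def A_def)
    have "(2 * k + 2) * m \<le> (2 * q) * m" using e(2) by (intro mult_right_mono) auto
    also have "\<dots> \<le> n" using qn(1) by (simp add: ac_simps)
    finally have "2 * k * m + 2 * m \<le> n" by (simp add: add_mult_distrib)
    then have "2 * k * m + i < n" "(2 * k + 1) * m + j < n" "2 * k * m + i \<noteq> (2 * k + 1) * m + j"
      using e(3,4) by (simp_all add: add_mult_distrib)
    then show ?thesis by (simp add: e(1) edge_def)
  qed
  then have simple: "simple_graph G" by (simp add: G_def simple_graph_def)
  have "proper_edge_coloring G c"
    unfolding proper_edge_coloring_def
  proof (intro ballI impI notI; elim conjE)
    fix e e' assume ee: "e \<in> edges G" "e' \<in> edges G" "e \<noteq> e'" "e \<inter> e' \<noteq> {}" "c e = c e'"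
    then obtain x y where xy: "e = edge x" "x \<in> A" "e' = edge y" "y \<in> A"
      by (simp add: G_def E_def image_iff) blast
    then have "x = y" using edge_unique ee(4,5) by (simp add: c_def)
    then show False using ee(3) xy by simp
  qed
  moreover have "\<not> (\<exists>H. copy_of_in H (broom t 3) G \<and> rainbow c H)"
  proof (intro notI, elim exE conjE)
    fix H assume H: "copy_of_in H (broom t 3) G" "rainbow c H"
    have "card (edges H) = t"
      using H(1) card_edges_graph_iso[of "broom t 3" H] card_edges_broom_3[OF t] t
      by (force simp: copy_of_in_def broom_def)
    moreover have "card (edges H) \<le> card {..<m}"
      using H(2) m by (intro card_inj_on_le[of c]) (auto simp: rainbow_def c_def)
    ultimately show False using t unfolding m_def by simp
  qed
  ultimately have "rainbow_free (broom t 3) G" unfolding rainbow_free_def by blast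
  then have "card E \<in> rainbow_edge_counts n (broom t 3)"
    unfolding rainbow_edge_counts_def using simple by (intro CollectI exI[of _ G]) (simp add: G_def)
  then have "card E \<le> rainbow_turan n (broom t 3)"
    unfolding rainbow_turan_def by (intro Max_ge finite_rainbow_edge_counts)
  moreover have "card E = q * (m * m)"
    using card_image[OF inj] by (simp add: E_def A_def card_cartesian_product)
  ultimately have "q * (m * m) \<le> rainbow_turan n (broom t 3)" by simp
  then have "real (q * (m * m)) \<le> real (rainbow_turan n (broom t 3))" by (simp only: of_nat_le_iff)
  then have lower: "real q * (real m * real m) \<le> real (rainbow_turan n (broom t 3))" by simp
  \<comment> \<open>Fewer than \<open>2 * m\<close> vertices are left over; at \<open>m / 2\<close>
    edges per vertex they cost at most the square of \<open>m\<close>.\<close>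
  have "m * n \<le> m * (2 * m * q + 2 * m)"
    using qn(2) by (intro mult_left_mono) linarith+
  then have "real (m * n) \<le> real (m * (2 * m * q + 2 * m))" by (simp only: of_nat_le_iff)
  then have upper: "real m / 2 * real n \<le> real q * (real m * real m) + (real m)\<^sup>2"
    by (simp add: power2_eq_square algebra_simps)
  have tm: "real t - 1 = real m" unfolding m_def using t by linarith
  show ?thesis
    unfolding tm m_def[symmetric] of_nat_power using lower upper by linarith
qed

section \<open>Rainbow-broom-free graphs in which every vertex set meets many edges\<close>

lemma inj_on_UnI:
  assumes "inj_on f A" "inj_on f B" "\<And>x y. x \<in> A \<Longrightarrow> y \<in> B \<Longrightarrow> f x \<noteq> f y"
  shows "inj_on f (A \<union> B)"
  using assms unfolding inj_on_Un by blast

text \<open>The situation in a smallest counterexample: a nonempty \<open>U\<close> violating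
  \<open>dense\<close> could be deleted. The density t(t+3)/(2(t+2)) equals (t+1)/2 - 1/(t+2), the
  number of edges per vertex of K_{t+2} with one edge removed.\<close>

locale dense_broom_free =
  fixes V :: "'a set" and E :: "'a set set" and col :: "'a set \<Rightarrow> nat" and t :: nat
  assumes simple: "simple_graph (V, E)"
    and proper: "proper_edge_coloring (V, E) col"
    and free: "\<not> (\<exists>H. copy_of_in H (broom t 3) (V, E) \<and> rainbow col H)"
    and t: "t \<ge> 4"
    and nonempty: "V \<noteq> {}"
    and dense: "\<And>U. U \<subseteq> V \<Longrightarrow> U \<noteq> {} \<Longrightarrow>
      t * (t + 3) * card U < 2 * (t + 2) * card {e \<in> E. e \<inter> U \<noteq> {}}"
begin

definition nbrs :: "'a \<Rightarrow> 'a set" where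
  "nbrs v = {u. {v, u} \<in> E}"

lemma nbrs_sym: "u \<in> nbrs v \<longleftrightarrow> v \<in> nbrs u"
  by (simp add: nbrs_def insert_commute)

lemma edgeD: "{u, w} \<in> E \<Longrightarrow> u \<in> V \<and> w \<in> V \<and> u \<noteq> w"
  using simple by (fastforce simp: simple_graph_def)

lemma nbrsD: "u \<in> nbrs v \<Longrightarrow> u \<in> V \<and> v \<in> V \<and> u \<noteq> v"
  using edgeD by (auto simp: nbrs_def)

lemma edgeE:
  assumes "e \<in> E"
  obtains u w where "e = {u, w}" "u \<noteq> w" "w \<in> nbrs u"
  using assms simple by (force simp: simple_graph_def nbrs_def card_2_iff)

lemma finite_V: "finite V"
  using simple by (simp add: simple_graph_def)

lemma finite_E: "finite E"
  by (rule finite_subset[of _ "Pow V"]) (use simple finite_V in \<open>auto simp: simple_graph_def\<close>)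

lemma finite_nbrs [simp]: "finite (nbrs v)"
  by (rule finite_subset[OF _ finite_V]) (auto dest: nbrsD)

lemma col_inj:
  assumes "u \<in> nbrs v" "w \<in> nbrs v" "col {v, u} = col {v, w}"
  shows "u = w"
proof (rule ccontr)
  assume "u \<noteq> w"
  then have "{v, u} \<noteq> {v, w} \<and> {v, u} \<inter> {v, w} \<noteq> {}" by (auto simp: doubleton_eq_iff)
  then show False using proper assms unfolding proper_edge_coloring_def nbrs_def by simp
qed

lemma card_col_le_1: "card {s \<in> nbrs v. col {v, s} = k} \<le> 1"
  by (auto simp: card_le_Suc0_iff_eq col_inj)

lemma card_nbrs: "card (nbrs v) = card {e \<in> E. v \<in> e}"
proof (rule bij_betw_same_card)
  show "bij_betw (\<lambda>u. {v, u}) (nbrs v) {e \<in> E. v \<in> e}"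
    unfolding bij_betw_def
  proof
    show "inj_on (\<lambda>u. {v, u}) (nbrs v)" by (auto simp: inj_on_def doubleton_eq_iff)
    show "(\<lambda>u. {v, u}) ` nbrs v = {e \<in> E. v \<in> e}"
      by (auto simp: nbrs_def image_iff insert_commute elim!: edgeE)
  qed
qed

text \<open>Closedness puts both ends of every edge meeting \<open>U\<close> into \<open>U\<close>,
  so each such edge is counted twice.\<close>

lemma sum_degrees_closed:
  assumes "U \<subseteq> V" "\<And>u w. u \<in> U \<Longrightarrow> w \<in> nbrs u \<Longrightarrow> w \<in> U"
  shows "(\<Sum>u\<in>U. card (nbrs u)) = 2 * card {e \<in> E. e \<inter> U \<noteq> {}}"
proof -
  have finU: "finite U" using assms(1) finite_V finite_subset by blast
  have "e \<subseteq> U" if "e \<in> E" "e \<inter> U \<noteq> {}" for e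
    using that assms(2) nbrs_sym by (elim edgeE) blast
  then have "{u \<in> U. u \<in> e} = e" if "e \<in> {e \<in> E. e \<inter> U \<noteq> {}}" for e
    using that by blast
  then have "(\<Sum>u\<in>U. card {e \<in> {e \<in> E. e \<inter> U \<noteq> {}}. u \<in> e}) = 2 * card {e \<in> E. e \<inter> U \<noteq> {}}"
    using finU finite_E simple by (intro sum_multicount) (auto simp: simple_graph_def)
  moreover have "{e \<in> {e \<in> E. e \<inter> U \<noteq> {}}. u \<in> e} = {e \<in> E. u \<in> e}" if "u \<in> U" for u
    using that by blast
  ultimately show ?thesis by (simp add: card_nbrs cong: sum.cong)
qed

section \<open>Handles at a vertex and the bristles they leave\<close>

text \<open>The handle of a broom centred at \<open>v\<close>, read from the centre outwards. The
  remaining distinctness of vertices and colours follows from adjacency and properness.\<close>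

definition rainbow_path :: "'a \<Rightarrow> 'a \<Rightarrow> 'a \<Rightarrow> 'a \<Rightarrow> bool" where
  "rainbow_path v a b w \<longleftrightarrow> a \<in> nbrs v \<and> b \<in> nbrs a \<and> w \<in> nbrs b \<and>
     v \<noteq> b \<and> w \<noteq> a \<and> w \<noteq> v \<and> col {b, w} \<noteq> col {v, a}"

text \<open>The set consists of the neighbours of \<open>v\<close> usable as bristles; the colour of
  the edge \<open>{v, a}\<close> is avoided because \<open>s\<close> differs from \<open>a\<close>.
  With \<open>t - 3\<close> of them, handle and bristles would form a rainbow broom.\<close>

lemma few_bristles:
  assumes "rainbow_path v a b w"
  shows "card {s \<in> nbrs v - {a, b, w}. col {v, s} \<noteq> col {a, b} \<and> col {v, s} \<noteq> col {b, w}} < t - 3"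
    (is "card ?S < _")
proof (rule ccontr)
  assume "\<not> card ?S < t - 3"
  then obtain S where S: "S \<subseteq> ?S" "card S = card {4..t}"
    using obtain_subset_with_card_n[of "t - 3" ?S] by (auto simp: not_less)
  have finS: "finite S" using S(1) finite_subset[of S "nbrs v"] by auto
  obtain g where g: "bij_betw g {4..t} S"
    using finite_same_card_bij[of "{4..t}" S] finS S(2) by auto
  \<comment> \<open>The bristles hang at vertex \<open>3\<close> of the broom, so \<open>3\<close>
    goes to \<open>v\<close> and the handle is traversed from \<open>w\<close> back to
    \<open>v\<close>.\<close>
  define f :: "nat \<Rightarrow> 'a" where
    "f i = (if i = 0 then w else if i = 1 then b else if i = 2 then a else if i = 3 then v else g i)" for i
  have f: "f 0 = w" "f 1 = b" "f 2 = a" "f 3 = v" "f ` {4..t} = S"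
    using g by (auto simp: f_def bij_betw_def image_iff intro!: image_cong)
  define H where "H = ({w, b, a, v} \<union> S, {{w, b}, {b, a}, {a, v}} \<union> (\<lambda>s. {v, s}) ` S)"
  note p = assms[unfolded rainbow_path_def]
  have vS: "v \<notin> S" using S(1) nbrsD by blast
  have dist: "distinct [w, b, a, v]" using p nbrsD by auto
  have "{0..t} = {0, 1, 2, 3} \<union> {4..t}" using t by auto
  moreover have "bij_betw f {0, 1, 2, 3} {w, b, a, v}"
    using dist f(1-4) by (auto simp: bij_betw_def inj_on_def)
  moreover have "bij_betw f {4..t} S"
    using g by (rule bij_betw_cong[THEN iffD1, rotated]) (auto simp: f_def)
  moreover have "{w, b, a, v} \<inter> S = {}" using S(1) vS by auto
  ultimately have "bij_betw f (verts (broom t 3)) (verts H)"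
    by (simp only: broom_def H_def fst_conv) (rule bij_betw_combine)
  moreover have "edges H = (\<lambda>e. f ` e) ` edges (broom t 3)"
    by (simp only: edges_broom_3 H_def snd_conv image_Un image_image image_insert image_empty f(1-4)
        f(5)[symmetric])
  ultimately have "graph_iso (broom t 3) H" unfolding graph_iso_def by blast
  moreover have "subgraph_of H (V, E)"
    using p S(1) finS nbrsD[of _ v] nbrsD dist
    by (auto simp: subgraph_of_def simple_graph_def H_def nbrs_def insert_commute card_insert_if)
  moreover have "rainbow col H"
  proof -
    have path_cols: "col {w, b} \<noteq> col {b, a}" "col {b, a} \<noteq> col {a, v}" "col {w, b} \<noteq> col {a, v}"
      using p col_inj[of w b a] col_inj[of b a v] nbrs_sym[of a b] nbrs_sym[of v a]
      by (auto simp: insert_commute)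
    have bristle_cols: "col {v, s} \<notin> {col {w, b}, col {b, a}, col {a, v}}" if "s \<in> S" for s
      using that S(1) p col_inj[of s v a] by (auto simp: insert_commute)
    have "col {v, s} = col {v, s'} \<Longrightarrow> s = s'" if "s \<in> S" "s' \<in> S" for s s'
      using that S(1) col_inj[of s v s'] by auto
    then have bristles: "inj_on col ((\<lambda>s. {v, s}) ` S)"
      by (intro inj_onI; elim imageE; metis)
    have path: "inj_on col {{w, b}, {b, a}, {a, v}}"
      by (rule inj_onI, elim insertE emptyE; simp add: path_cols path_cols[symmetric])
    have "col e \<noteq> col e'" if e: "e \<in> {{w, b}, {b, a}, {a, v}}" "e' \<in> (\<lambda>s. {v, s}) ` S" for e e'
    proof
      assume eq: "col e = col e'"
      obtain s where s: "e' = {v, s}" "s \<in> S" using e(2) by (rule imageE)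
      have "col e \<in> {col {w, b}, col {b, a}, col {a, v}}"
        using e(1) by (elim insertE emptyE; simp)
      then have "col {v, s} \<in> {col {w, b}, col {b, a}, col {a, v}}" by (simp only: eq s(1))
      then show False using bristle_cols[OF s(2)] by (rule notE[rotated])
    qed
    then have "inj_on col ({{w, b}, {b, a}, {a, v}} \<union> (\<lambda>s. {v, s}) ` S)"
      by (rule inj_on_UnI[OF path bristles])
    then show ?thesis unfolding rainbow_def H_def snd_conv .
  qed
  ultimately show False using free unfolding copy_of_in_def by blast
qed

text \<open>At most \<open>t - 4\<close> neighbours of \<open>v\<close> are usable as bristles. The
  others are among \<open>a\<close>, \<open>b\<close>, \<open>w\<close> and the at most two
  neighbours reached by the colours of \<open>ab\<close> and \<open>bw\<close>. These five
  exceptions give at most \<open>t + 1\<close> neighbours, so degree \<open>t + 1\<close> needs all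
  of them to occur and to be different.\<close>

lemma rainbow_path_high_degree:
  assumes path: "rainbow_path v a b w" and deg: "t + 1 \<le> card (nbrs v)"
  shows "card (nbrs v) = t + 1" "b \<in> nbrs v" "\<exists>s\<in>nbrs v. col {v, s} = col {a, b}"
    "w \<in> nbrs v \<Longrightarrow> col {v, w} \<noteq> col {a, b}"
proof -
  let ?S = "{s \<in> nbrs v - {a, b, w}. col {v, s} \<noteq> col {a, b} \<and> col {v, s} \<noteq> col {b, w}}"
  let ?P = "{s \<in> nbrs v. col {v, s} = col {a, b}}"
  let ?Q = "{s \<in> nbrs v. col {v, s} = col {b, w}}"
  let ?B = "{b} \<inter> nbrs v"
  \<comment> \<open>Here \<open>w\<close> counts only if it is not already counted in
    \<open>?P\<close>, so that \<open>?W\<close> being nonempty yields the last claim.\<close>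
  let ?W = "{w} \<inter> (nbrs v - ?P)"
  have "nbrs v \<subseteq> ?S \<union> {a} \<union> ?B \<union> ?W \<union> ?P \<union> ?Q" by blast
  then have "card (nbrs v) \<le> card (?S \<union> {a} \<union> ?B \<union> ?W \<union> ?P \<union> ?Q)"
    by (intro card_mono) auto
  also have "\<dots> \<le> card ?S + card {a} + card ?B + card ?W + card ?P + card ?Q"
    by (meson card_Un_le add_le_mono le_trans order_refl)
  finally have le: "card (nbrs v) \<le> card ?S + 1 + card ?B + card ?W + card ?P + card ?Q" by simp
  have one: "card ?B \<le> 1" "card ?W \<le> 1"
    using card_mono[of "{b}" ?B] card_mono[of "{w}" ?W] by auto
  note bounds = le one card_col_le_1[of v "col {a, b}"] card_col_le_1[of v "col {b, w}"]
    few_bristles[OF path] deg t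
  show "card (nbrs v) = t + 1" using bounds by linarith
  have "card ?B \<noteq> 0" using bounds by linarith
  then have "?B \<noteq> {}" by (metis card.empty)
  then show "b \<in> nbrs v" by blast
  have "card ?P \<noteq> 0" using bounds by linarith
  then have "?P \<noteq> {}" by (metis card.empty)
  then show "\<exists>s\<in>nbrs v. col {v, s} = col {a, b}" by blast
  have "card ?W \<noteq> 0" using bounds by linarith
  then have "?W \<noteq> {}" by (metis card.empty)
  then show "w \<in> nbrs v \<Longrightarrow> col {v, w} \<noteq> col {a, b}" by blast
qed

text \<open>Besides \<open>F\<close>, only the at most one neighbour reached by colour
  \<open>k\<close> has to be avoided.\<close>

lemma exists_extension:
  assumes "finite F" "card F + 2 \<le> card (nbrs b)"
  shows "\<exists>w\<in>nbrs b - F. col {b, w} \<noteq> k"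
proof (rule ccontr)
  assume "\<not> ?thesis"
  then have "nbrs b \<subseteq> F \<union> {s \<in> nbrs b. col {b, s} = k}" by blast
  then have "card (nbrs b) \<le> card (F \<union> {s \<in> nbrs b. col {b, s} = k})"
    using assms(1) by (intro card_mono) simp_all
  also have "\<dots> \<le> card F + card {s \<in> nbrs b. col {b, s} = k}" by (rule card_Un_le)
  finally show False using card_col_le_1[of b k] assms(2) by linarith
qed

section \<open>Degrees forced by the density\<close>

text \<open>The density is at least two edges per vertex. This rules out degrees below 3, and closed
  neighbourhoods in which all but the centre have degree at most 3.\<close>

lemma four_mult_le: "4 * (t + 2) \<le> t * (t + 3)"
proof -
  have "4 * t \<le> t * t" using t by (rule mult_right_mono) simp
  then show ?thesis using t unfolding distrib_left by linarith
qed

lemma min_degree: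
  assumes "v \<in> V"
  shows "3 \<le> card (nbrs v)"
proof (rule ccontr)
  assume "\<not> ?thesis"
  then have "2 * (t + 2) * card (nbrs v) \<le> 2 * (t + 2) * 2" by (intro mult_left_mono) linarith+
  moreover have "{e \<in> E. e \<inter> {v} \<noteq> {}} = {e \<in> E. v \<in> e}" by blast
  then have "t * (t + 3) < 2 * (t + 2) * card (nbrs v)"
    using dense[of "{v}"] assms card_nbrs[of v] by simp
  ultimately show False using four_mult_le by linarith
qed

text \<open>If all degrees were at most \<open>t\<close>, there would be at most t/2 edges per
  vertex, which is below the density.\<close>

lemma exists_high_degree: "\<exists>v\<in>V. t + 1 \<le> card (nbrs v)"
proof (rule ccontr)
  assume "\<not> ?thesis"
  then have "(\<Sum>v\<in>V. card (nbrs v)) \<le> card V * t"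
    using sum_bounded_above[of V "\<lambda>v. card (nbrs v)" t] by (force simp: not_le)
  then have "2 * card {e \<in> E. e \<inter> V \<noteq> {}} \<le> card V * t"
    using sum_degrees_closed[of V] nbrsD by auto
  then have "(t + 2) * (2 * card {e \<in> E. e \<inter> V \<noteq> {}}) \<le> (t + 2) * (card V * t)"
    by (rule mult_left_mono) simp
  moreover have "t * (t + 3) * card V < 2 * (t + 2) * card {e \<in> E. e \<inter> V \<noteq> {}}"
    using dense nonempty by blast
  ultimately show False by (simp add: algebra_simps)
qed

text \<open>If \<open>b\<close> were not adjacent to \<open>v\<close>, the walk \<open>v a b\<close>
  would extend to a rainbow path, since degree 3 at \<open>b\<close> leaves a neighbour other than
  \<open>a\<close> that avoids one colour. Such a path forces \<open>b\<close> to be adjacent to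
  \<open>v\<close> after all.\<close>

lemma high_degree_closed:
  assumes deg: "t + 1 \<le> card (nbrs v)" and ab: "a \<in> nbrs v" "b \<in> nbrs a" "b \<noteq> v"
  shows "b \<in> nbrs v"
proof (rule ccontr)
  assume b: "b \<notin> nbrs v"
  obtain w where w: "w \<in> nbrs b - {a}" "col {b, w} \<noteq> col {v, a}"
    using exists_extension[of "{a}" b "col {v, a}"] min_degree[of b] nbrsD ab by auto
  have "w \<noteq> v" using b w nbrs_sym by blast
  then have "rainbow_path v a b w" using ab w by (auto simp: rainbow_path_def)
  then show False using rainbow_path_high_degree(2) deg b by blast
qed

text \<open>For a larger degree \<open>k\<close>, no rainbow path starts at \<open>v\<close>, which
  bounds the degrees of its neighbours by 3. The closed neighbourhood then has \<open>k + 1\<close>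
  vertices and meets at most \<open>2 * k\<close> edges, too few for the density.\<close>

lemma high_degree_eq:
  assumes deg: "t + 1 \<le> card (nbrs v)"
  shows "card (nbrs v) = t + 1"
proof (rule ccontr)
  assume neq: "card (nbrs v) \<noteq> t + 1"
  let ?U = "insert v (nbrs v)"
  let ?k = "card (nbrs v)"
  have "nbrs v \<noteq> {}"
  proof
    assume "nbrs v = {}"
    then show False using deg by simp
  qed
  then have U: "?U \<subseteq> V" using nbrsD by blast
  have le3: "card (nbrs a) \<le> 3" if a: "a \<in> nbrs v" for a
  proof (rule ccontr)
    assume "\<not> ?thesis"
    then have d: "4 \<le> card (nbrs a)" by simp
    obtain b where b: "b \<in> nbrs a - {v}" using exists_extension[of "{v}" a] d by auto
    \<comment> \<open>Here \<open>a\<close> becomes the third vertex of the path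
      \<open>v b a w\<close>; degree 4 leaves room to avoid \<open>v\<close>, \<open>b\<close> and
      one colour.\<close>
    have "card {v, b} + 2 \<le> card (nbrs a)" using d by (simp add: card_insert_if)
    then obtain w where w: "w \<in> nbrs a - {v, b}" "col {a, w} \<noteq> col {v, b}"
      using exists_extension[of "{v, b}" a] by blast
    have "b \<in> nbrs v" using high_degree_closed[OF deg a] b by blast
    then have "rainbow_path v b a w"
      using a b w nbrsD[OF a] nbrs_sym by (auto simp: rainbow_path_def)
    then show False using rainbow_path_high_degree(1) deg neq by blast
  qed
  have v: "v \<notin> nbrs v" using nbrsD by blast
  have "2 * card {e \<in> E. e \<inter> ?U \<noteq> {}} = (\<Sum>u\<in>?U. card (nbrs u))"
    using U high_degree_closed[OF deg] by (intro sum_degrees_closed[symmetric]) auto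
  also have "\<dots> = ?k + (\<Sum>u\<in>nbrs v. card (nbrs u))" using v by simp
  also have "\<dots> \<le> ?k + ?k * 3" using le3 sum_bounded_above[of "nbrs v" "\<lambda>u. card (nbrs u)" 3] by simp
  finally have le: "2 * card {e \<in> E. e \<inter> ?U \<noteq> {}} \<le> 4 * ?k" by linarith
  have "(t + 2) * (4 * (?k + 1)) = 4 * (t + 2) * (?k + 1)" by (simp only: ac_simps)
  also have "\<dots> \<le> t * (t + 3) * (?k + 1)"
    using four_mult_le by (rule mult_right_mono) simp
  also have "\<dots> < 2 * (t + 2) * card {e \<in> E. e \<inter> ?U \<noteq> {}}" using dense[OF U] v by simp
  also have "\<dots> = (t + 2) * (2 * card {e \<in> E. e \<inter> ?U \<noteq> {}})" by (simp only: ac_simps)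
  finally have "4 * (?k + 1) < 2 * card {e \<in> E. e \<inter> ?U \<noteq> {}}" by (simp only: mult_less_cancel1)
  then have "4 * (?k + 1) < 4 * ?k" using le by (rule less_le_trans)
  then show False by simp
qed

section \<open>A complete component and its group structure\<close>

text \<open>The closed neighbourhood of a vertex of high degree has \<open>t + 2\<close> vertices
  and no edges leaving it. It meets strictly more edges than K_{t+2} with one edge removed has, so
  no pair is missing.\<close>

lemma exists_complete_component:
  "\<exists>U \<subseteq> V. card U = t + 2 \<and> (\<forall>u\<in>U. nbrs u = U - {u})"
proof -
  obtain v where v: "v \<in> V" "t + 1 \<le> card (nbrs v)" using exists_high_degree by blast
  define U where "U = insert v (nbrs v)"
  have UV: "U \<subseteq> V" using v nbrsD by (auto simp: U_def)
  have finU: "finite U" by (simp add: U_def)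
  have cardU: "card U = t + 2" using high_degree_eq[OF v(2)] nbrsD by (auto simp: U_def card_insert_if)
  have closed: "w \<in> U" if "u \<in> U" "w \<in> nbrs u" for u w
    using that high_degree_closed[OF v(2)] by (auto simp: U_def)
  let ?EU = "{e \<in> E. e \<inter> U \<noteq> {}}"
  let ?K = "{e. e \<subseteq> U \<and> card e = 2}"
  have sub: "?EU \<subseteq> ?K"
  proof
    fix e assume "e \<in> ?EU"
    then have e: "e \<in> E" "e \<inter> U \<noteq> {}" by blast+
    obtain u w where uw: "e = {u, w}" "u \<noteq> w" "w \<in> nbrs u" using e(1) by (rule edgeE)
    then have "u \<in> U \<and> w \<in> U" using e(2) closed nbrs_sym by blast
    then show "e \<in> ?K" using uw by simp
  qed
  have finK: "finite ?K" by (rule finite_subset[of _ "Pow U"]) (use finU in auto)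
  have "card ?K = (t + 2) * (t + 1) div 2"
    using n_subsets[OF finU, of 2] cardU by (simp only: choose_two) simp
  moreover have "even ((t + 2) * (t + 1))" by simp
  ultimately have K: "2 * card ?K = (t + 2) * (t + 1)" by (simp only: dvd_mult_div_cancel)
  have "(t + 2) * (t * (t + 3)) = t * (t + 3) * card U" by (simp only: cardU ac_simps)
  also have "\<dots> < 2 * (t + 2) * card ?EU" using dense[OF UV] by (simp only: U_def) simp
  also have "\<dots> = (t + 2) * (2 * card ?EU)" by (simp only: ac_simps)
  finally have "t * (t + 3) < 2 * card ?EU" by (simp only: mult_less_cancel1)
  moreover have "(t + 2) * (t + 1) = t * (t + 3) + 2" by (simp add: algebra_simps)
  ultimately have "2 * card ?K < 2 * card ?EU + 2" unfolding K by (simp only: add_less_cancel_right)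
  then have "card ?K \<le> card ?EU" by simp
  then have eq: "?EU = ?K" by (rule card_subset_eq[OF finK sub antisym[OF card_mono[OF finK sub]]])
  have "nbrs u = U - {u}" if "u \<in> U" for u
  proof
    show "nbrs u \<subseteq> U - {u}" using closed that nbrsD by blast
    show "U - {u} \<subseteq> nbrs u"
    proof
      fix w assume "w \<in> U - {u}"
      then have "{u, w} \<in> ?K" using that by (auto simp: card_insert_if)
      then show "w \<in> nbrs u" using eq by (auto simp: nbrs_def)
    qed
  qed
  then show ?thesis using UV cardU by blast
qed

text \<open>Every vertex of the component sees every colour, so a colour is a fixed-point-free
  involution, and the missing rainbow broom makes these involutions commute.\<close>

lemma power_of_two: "\<exists>k. t + 2 = 2 ^ k"
proof -
  obtain U where U: "U \<subseteq> V" "card U = t + 2" and nb: "\<And>u. u \<in> U \<Longrightarrow> nbrs u = U - {u}"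
    using exists_complete_component by blast
  have finU: "finite U" using U(1) finite_V finite_subset by blast
  have deg: "card (nbrs u) = t + 1" if "u \<in> U" for u using that nb U(2) finU by simp
  have ext: "\<exists>w. rainbow_path u a b w" if "u \<in> U" "a \<in> U" "b \<in> U" "distinct [u, a, b]" for u a b
  proof -
    have "card {u, a} + 2 \<le> card (nbrs b)" using that deg t by simp
    then obtain w where "w \<in> nbrs b - {u, a}" "col {b, w} \<noteq> col {u, a}"
      using exists_extension[of "{u, a}" b] by blast
    then show ?thesis using that nb by (auto simp: rainbow_path_def)
  qed
  \<comment> \<open>For \<open>u\<close> off the edge \<open>ab\<close>, a rainbow path starting
    with \<open>u a b\<close> forces the colour of \<open>ab\<close> to occur at
    \<open>u\<close>.\<close>
  have sees: "\<exists>s\<in>U - {u}. col {u, s} = col {a, b}" if ab: "u \<in> U" "a \<in> U" "b \<in> U" "a \<noteq> b" for u a b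
  proof (cases "u = a \<or> u = b")
    case True
    then show ?thesis using ab by (auto simp: insert_commute)
  next
    case False
    then obtain w where "rainbow_path u a b w" using ext[of u a b] ab by auto
    then show ?thesis using rainbow_path_high_degree(3) deg nb ab(1) by fastforce
  qed
  obtain z where z: "z \<in> U" using U(2) by fastforce
  \<comment> \<open>Colours are named by the vertices they lead to from \<open>z\<close>:
    \<open>F x\<close> moves each vertex along its edge of the colour of \<open>{z, x}\<close>. The
    base point \<open>z\<close> names the identity.\<close>
  define F where "F x u = (if x = z then u else SOME s. s \<in> U - {u} \<and> col {u, s} = col {z, x})" for x u
  have F: "F x u \<in> U - {u} \<and> col {u, F x u} = col {z, x}" if "x \<in> U" "u \<in> U" "x \<noteq> z" for x u
    using someI_ex[of "\<lambda>s. s \<in> U - {u} \<and> col {u, s} = col {z, x}"] sees[of u z x] that z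
    by (auto simp: F_def)
  have Fz: "F z u = u" for u by (simp add: F_def)
  have FU: "F x u \<in> U" if "x \<in> U" "u \<in> U" for x u using F[OF that] Fz that by (cases "x = z") auto
  have uniq: "s = s'" if "u \<in> U" "s \<in> U - {u}" "s' \<in> U - {u}" "col {u, s} = col {u, s'}" for u s s'
    using col_inj nb that by metis
  have comm: "F x (F y u) = F y (F x u)" if xy: "x \<in> U" "y \<in> U" and u: "u \<in> U" for x y u
  proof (cases "x = z \<or> y = z \<or> x = y")
    case True
    then show ?thesis by (auto simp: Fz)
  next
    case False
    then have neq: "col {z, x} \<noteq> col {z, y}" using uniq[OF z, of x y] xy by auto
    define a where "a = F x u"
    define b where "b = F y a"
    define c where "c = F y u"
    have a: "a \<in> U" "a \<noteq> u" "col {u, a} = col {z, x}" using F[of x u] False xy u by (auto simp: a_def)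
    have b: "b \<in> U" "b \<noteq> a" "col {a, b} = col {z, y}" using F[of y a] False xy a by (auto simp: b_def)
    have c: "c \<in> U" "c \<noteq> u" "col {u, c} = col {z, y}" using F[of y u] False xy u by (auto simp: c_def)
    have "b \<noteq> u" using a b neq by (auto simp: insert_commute)
    have "c \<noteq> a" using a c neq by auto
    have "c \<noteq> b" using uniq[of b a u] a b c u \<open>b \<noteq> u\<close> by (auto simp: insert_commute)
    \<comment> \<open>The edges \<open>ab\<close> and \<open>uc\<close> share a colour. If
      \<open>bc\<close> and \<open>ua\<close> did not, \<open>u a b c\<close> would be a rainbow
      path whose end \<open>c\<close> is joined to \<open>u\<close> in the colour of
      \<open>ab\<close>, which is impossible at degree \<open>t + 1\<close>. So the two walks from
      \<open>u\<close> close up to a 4-cycle.\<close>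
    have "col {b, c} = col {u, a}"
    proof (rule ccontr)
      assume "col {b, c} \<noteq> col {u, a}"
      then have "rainbow_path u a b c"
        using a b c u nb \<open>b \<noteq> u\<close> \<open>c \<noteq> a\<close> \<open>c \<noteq> b\<close> by (auto simp: rainbow_path_def)
      moreover have "t + 1 \<le> card (nbrs u)" "c \<in> nbrs u" using deg nb u c by simp_all
      ultimately have "col {u, c} \<noteq> col {a, b}" by (rule rainbow_path_high_degree(4))
      then show False using b(3) c(3) by simp
    qed
    then have "F x c = b"
      using uniq[of c "F x c" b] F[of x c] a b c xy False \<open>c \<noteq> b\<close> by (auto simp: insert_commute)
    then show ?thesis by (simp add: a_def b_def c_def)
  qed
  have invol: "F x (F x u) = u" if "x \<in> U" "u \<in> U" for x u
  proof (cases "x = z")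
    case False
    have "F x u \<in> U - {u}" "col {u, F x u} = col {z, x}" using F[OF that False] by auto
    then show ?thesis
      using F[of x "F x u"] uniq[of "F x u" "F x (F x u)" u] that False by (auto simp: insert_commute)
  qed (simp add: Fz)
  have "F x z = x" if "x \<in> U" for x
    using F[OF that z] uniq[OF z, of "F x z" x] that by (cases "x = z") (auto simp: Fz)
  then have "\<exists>k. card U = 2 ^ k"
    using card_power_of_two_if_commuting_involutions[OF finU z, of F] FU invol comm by blast
  then show ?thesis using U(2) by simp
qed

end

section \<open>The upper bound, and both bounds together\<close>

text \<open>Induction on the number of vertices. A nonempty \<open>U\<close> meeting few edges is
  deleted along with them, and the bounds for the two parts add up; if there is no such
  \<open>U\<close>, the graph satisfies \<open>dense_broom_free\<close> and \<open>t + 2\<close> is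
  a power of two.\<close>

lemma card_edges_rainbow_broom_free_le:
  fixes V :: "'a set"
  assumes "simple_graph (V, E)" "rainbow_free (broom t 3) (V, E)" "t \<ge> 4" "\<nexists>k. t + 2 = 2 ^ k"
  shows "2 * (t + 2) * card E \<le> t * (t + 3) * card V"
  using assms(1,2)
proof (induction "card V" arbitrary: V E rule: less_induct)
  case less
  obtain col where col: "proper_edge_coloring (V, E) col"
    "\<not> (\<exists>H. copy_of_in H (broom t 3) (V, E) \<and> rainbow col H)"
    using less.prems(2) unfolding rainbow_free_def by blast
  have finV: "finite V" and sub: "\<And>e. e \<in> E \<Longrightarrow> e \<subseteq> V \<and> card e = 2"
    using less.prems(1) by (auto simp: simple_graph_def)
  have finE: "finite E" by (rule finite_subset[of _ "Pow V"]) (use sub finV in auto)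
  show ?case
  proof (cases "V = {}")
    case True
    then have "E = {}" using sub by fastforce
    then show ?thesis by simp
  next
    case False
    have "\<exists>U\<subseteq>V. U \<noteq> {} \<and> 2 * (t + 2) * card {e \<in> E. e \<inter> U \<noteq> {}} \<le> t * (t + 3) * card U"
    proof (rule ccontr)
      assume sparse: "\<not> ?thesis"
      have "t * (t + 3) * card U < 2 * (t + 2) * card {e \<in> E. e \<inter> U \<noteq> {}}"
        if "U \<subseteq> V" "U \<noteq> {}" for U
        using that sparse by (meson not_less)
      then have "dense_broom_free V E col t"
        using less.prems(1) col assms(3) False by unfold_locales
      then show False using dense_broom_free.power_of_two assms(4) by blast
    qed
    then obtain U where U: "U \<subseteq> V" "U \<noteq> {}"
      "2 * (t + 2) * card {e \<in> E. e \<inter> U \<noteq> {}} \<le> t * (t + 3) * card U"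
      by blast
    let ?E = "{e \<in> E. e \<inter> U = {}}"
    have "simple_graph (V - U, ?E)" using finV sub by (auto simp: simple_graph_def)
    moreover have "rainbow_free (broom t 3) (V - U, ?E)"
      unfolding rainbow_free_def
    proof (intro exI conjI)
      show "proper_edge_coloring (V - U, ?E) col"
        using col(1) by (simp add: proper_edge_coloring_def)
      have "copy_of_in H (broom t 3) (V, E)" if "copy_of_in H (broom t 3) (V - U, ?E)" for H
        using that by (auto simp: copy_of_in_def subgraph_of_def)
      then show "\<not> (\<exists>H. copy_of_in H (broom t 3) (V - U, ?E) \<and> rainbow col H)"
        using col(2) by blast
    qed
    moreover have "card (V - U) < card V"
      using U finV by (intro psubset_card_mono) auto
    ultimately have "2 * (t + 2) * card ?E \<le> t * (t + 3) * card (V - U)"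
      using less.hyps by blast
    moreover have "E = {e \<in> E. e \<inter> U \<noteq> {}} \<union> ?E" by blast
    then have "card E = card ({e \<in> E. e \<inter> U \<noteq> {}} \<union> ?E)" by (rule arg_cong)
    then have "card E = card {e \<in> E. e \<inter> U \<noteq> {}} + card ?E"
      using finE by (subst (asm) card_Un_disjoint) auto
    moreover have "card V = card U + card (V - U)"
      using card_Un_disjoint[of U "V - U"] U(1) finV finite_subset[OF U(1)] by (simp add: Un_absorb1)
    ultimately show ?thesis using U(3) by (simp only: add_mult_distrib2 add_mono)
  qed
qed

theorem theorem1p5:
  fixes t :: nat
  assumes "t \<ge> 3" and "even t"
    and "\<forall>s::int. real t \<noteq> 2 powi s - 2"
  shows "\<exists>g :: nat \<Rightarrow> real. g \<in> O(\<lambda>_. 1) \<and>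
    (\<forall>n::nat.
      (real t - 1) / 2 * real n + g n \<le> real (rainbow_turan n (broom t 3)) \<and>
      real (rainbow_turan n (broom t 3)) \<le> ((real t + 1) / 2 - 1 / (real t + 2)) * real n)"
proof -
  have t: "t \<ge> 4" using assms(1,2) by (cases "t = 3") auto
  have pow: "\<nexists>k. t + 2 = 2 ^ k"
  proof
    assume "\<exists>k. t + 2 = 2 ^ k"
    then obtain k where "t + 2 = 2 ^ k" by blast
    then have "real t + 2 = 2 ^ k" by (metis of_nat_add of_nat_numeral of_nat_power)
    then have "real t = 2 powi (int k) - 2" by (simp add: power_int_of_nat)
    then show False using assms(3) by blast
  qed
  have upper: "real (rainbow_turan n (broom t 3)) \<le> ((real t + 1) / 2 - 1 / (real t + 2)) * real n" for n
  proof -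
    \<comment> \<open>The broom has an edge, so the set of edge counts is nonempty and its
      \<open>Max\<close> is attained.\<close>
    have "edges (broom t 3) \<noteq> {}" by (simp add: edges_broom_3)
    then have "rainbow_turan n (broom t 3) \<in> rainbow_edge_counts n (broom t 3)"
      unfolding rainbow_turan_def
      by (intro Max_in finite_rainbow_edge_counts rainbow_edge_counts_nonempty)
    then obtain G :: "nat graph" where "rainbow_turan n (broom t 3) = card (edges G)"
      "simple_graph G" "card (verts G) = n" "rainbow_free (broom t 3) G"
      unfolding rainbow_edge_counts_def by auto
    then have "2 * (t + 2) * rainbow_turan n (broom t 3) \<le> t * (t + 3) * n"
      using card_edges_rainbow_broom_free_le[of "verts G" "edges G" t] t pow by simp
    then have "real (2 * (t + 2) * rainbow_turan n (broom t 3)) \<le> real (t * (t + 3) * n)"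
      by (simp only: of_nat_le_iff)
    then have le: "2 * (real t + 2) * real (rainbow_turan n (broom t 3)) \<le> real t * (real t + 3) * real n"
      by (simp only: of_nat_mult of_nat_add of_nat_numeral)
    have pos: "2 * (real t + 2) > 0" by simp
    define d where "d = 1 / (real t + 2)"
    have d: "(real t + 2) * d = 1" using pos by (simp add: d_def)
    \<comment> \<open>Clearing denominators turns the coefficient of the theorem into the one of the
      integer bound.\<close>
    have "2 * (real t + 2) * ((real t + 1) / 2 - d) = (real t + 2) * (real t + 1) - 2 * ((real t + 2) * d)"
      by (simp add: field_simps)
    also have "\<dots> = real t * (real t + 3)" unfolding d by (simp add: algebra_simps)
    finally have "2 * (real t + 2) * ((real t + 1) / 2 - 1 / (real t + 2)) = real t * (real t + 3)"
      by (simp only: d_def)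
    then have "2 * (real t + 2) * real (rainbow_turan n (broom t 3)) \<le>
        2 * (real t + 2) * (((real t + 1) / 2 - 1 / (real t + 2)) * real n)"
      using le by (simp only: mult.assoc[symmetric])
    then show ?thesis by (simp only: mult_le_cancel_left_pos[OF pos])
  qed
  show ?thesis
  proof (intro exI conjI allI)
    show "(\<lambda>_. - real ((t - 1)\<^sup>2)) \<in> O(\<lambda>_. 1)" by simp
    show "(real t - 1) / 2 * real n + - real ((t - 1)\<^sup>2) \<le> real (rainbow_turan n (broom t 3))" for n
      using rainbow_turan_broom_lower[OF assms(1), of n] by (simp only: diff_conv_add_uminus)
  qed (rule upper)
qed

end
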